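(* Let $\Gamma$ be a connected signed graph of order $n\geq 2$. Then $$i_+(\Gamma)\geq \frac{n-p(\Gamma)}{2}-\theta(\Gamma).$$ Moreover, $$i_+(\Gamma)\geq \frac{n-p(\Gamma)+1}{2}-\theta(\Gamma)$$ if either $p(\Gamma)\geq 1$, or $p(\Gamma)=0$ and there are two distinct cycles of $\Gamma$ that have common vertices.
   Context: All graphs are finite and simple. A signed graph $\Gamma=(G,\sigma)$ consists of a simple graph $G=(V(G),E(G))$ (the underlying graph) and a sign function $\sigma:E(G)\to\{+,-\}$. Its order is $n=|V(G)|$. Graph-theoretic notions for $\Gamma$ (connectedness, degree, cycles, components) refer to $G$. The adjacency matrix $A(\Gamma)$ is the real symmetric matrix indexed by $V(G)$ whose $(u,v)$ entry is $+1$ if $uv\in E(G)$ and $\sigma(uv)=+$, $-1$ if $uv\in E(G)$ and $\sigma(uv)=-$, and $0$ if $uv\notin E(G)$. The positive inertia index $i_+(\Gamma)$ is the number of positive eigenvalues of $A(\Gamma)$, counted with multiplicity. The cyclomatic number is $\theta(\Gamma)=|E(G)|-|V(G)|+c(G)$, where $c(G)$ is the number of connected components of $G$. A pendant vertex is a vertex of degree $1$, and $p(\Gamma)$ denotes the number of pendant vertices of $\Gamma$. *)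

theory Defs
  imports "Jordan_Normal_Form.Char_Poly"
begin

datatype sign = Plus | Minus

text \<open>Edges are two-element vertex sets. The sign function is total on sets of vertices, but only
  its values on edges are ever used.\<close>

record 'a sgraph =
  vertices :: "'a set"
  edges :: "'a set set"
  sgn_of :: "'a set \<Rightarrow> sign"

locale signed_graph =
  fixes \<Gamma> :: "'a sgraph"
  assumes finite_vertices: "finite (vertices \<Gamma>)"
    and edges_wf: "e \<in> edges \<Gamma> \<Longrightarrow> e \<subseteq> vertices \<Gamma> \<and> card e = 2"

definition adj_rel :: "'a sgraph \<Rightarrow> 'a rel" where
  "adj_rel \<Gamma> = {(u, v). {u, v} \<in> edges \<Gamma>}"

definition reach_rel :: "'a sgraph \<Rightarrow> 'a rel" where
  "reach_rel \<Gamma> = (adj_rel \<Gamma>)\<^sup>* \<inter> vertices \<Gamma> \<times> vertices \<Gamma>"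

definition components :: "'a sgraph \<Rightarrow> 'a set set" where
  "components \<Gamma> = vertices \<Gamma> // reach_rel \<Gamma>"

definition connected_sgraph :: "'a sgraph \<Rightarrow> bool" where
  "connected_sgraph \<Gamma> \<longleftrightarrow> vertices \<Gamma> \<noteq> {} \<and>
     (\<forall>u \<in> vertices \<Gamma>. \<forall>v \<in> vertices \<Gamma>. (u, v) \<in> reach_rel \<Gamma>)"

definition cyclomatic :: "'a sgraph \<Rightarrow> int" where
  "cyclomatic \<Gamma> =
     int (card (edges \<Gamma>)) - int (card (vertices \<Gamma>)) + int (card (components \<Gamma>))"

definition vertex_degree :: "'a sgraph \<Rightarrow> 'a \<Rightarrow> nat" where
  "vertex_degree \<Gamma> v = card {e \<in> edges \<Gamma>. v \<in> e}"

definition num_pendant :: "'a sgraph \<Rightarrow> nat" where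
  "num_pendant \<Gamma> = card {v \<in> vertices \<Gamma>. vertex_degree \<Gamma> v = 1}"

text \<open>A cycle is a subgraph, given by its vertex set and edge set; cyclic shifts and reversals of
  the traversing list yield the same cycle.\<close>

definition cycle_edges :: "'a list \<Rightarrow> 'a set set" where
  "cycle_edges vs = {{vs ! i, vs ! (Suc i mod length vs)} | i. i < length vs}"

definition cycles :: "'a sgraph \<Rightarrow> ('a set \<times> 'a set set) set" where
  "cycles \<Gamma> = {(set vs, cycle_edges vs) | vs.
     length vs \<ge> 3 \<and> distinct vs \<and> set vs \<subseteq> vertices \<Gamma> \<and> cycle_edges vs \<subseteq> edges \<Gamma>}"

definition adj_entry :: "'a sgraph \<Rightarrow> 'a \<Rightarrow> 'a \<Rightarrow> real" where
  "adj_entry \<Gamma> u v =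
     (if {u, v} \<in> edges \<Gamma> then (case sgn_of \<Gamma> {u, v} of Plus \<Rightarrow> 1 | Minus \<Rightarrow> -1) else 0)"

definition adj_matrix_wrt :: "'a sgraph \<Rightarrow> 'a list \<Rightarrow> real mat" where
  "adj_matrix_wrt \<Gamma> vs =
     mat (length vs) (length vs) (\<lambda>(i, j). adj_entry \<Gamma> (vs ! i) (vs ! j))"

text \<open>Matrices here are indexed by natural numbers, so the rows and columns are labelled by an
  arbitrary enumeration of the vertices; the characteristic polynomial does not depend on it (lemma
  \<open>char_poly_adj_matrix_wrt\<close> below).\<close>

definition vertex_list :: "'a sgraph \<Rightarrow> 'a list" where
  "vertex_list \<Gamma> = (SOME vs. distinct vs \<and> set vs = vertices \<Gamma>)"

definition adj_matrix :: "'a sgraph \<Rightarrow> real mat" where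
  "adj_matrix \<Gamma> = adj_matrix_wrt \<Gamma> (vertex_list \<Gamma>)"

definition pos_inertia_mat :: "real mat \<Rightarrow> nat" where
  "pos_inertia_mat A = (\<Sum>x | eigenvalue A x \<and> x > 0. Polynomial.order x (char_poly A))"

definition pos_inertia :: "'a sgraph \<Rightarrow> nat" where
  "pos_inertia \<Gamma> = pos_inertia_mat (adj_matrix \<Gamma>)"

lemma (in signed_graph) vertex_list:
  "distinct (vertex_list \<Gamma>)" "set (vertex_list \<Gamma>) = vertices \<Gamma>"
proof -
  have "\<exists>vs. distinct vs \<and> set vs = vertices \<Gamma>"
    using finite_distinct_list[OF finite_vertices] by blast
  from someI_ex[OF this] show "distinct (vertex_list \<Gamma>)" "set (vertex_list \<Gamma>) = vertices \<Gamma>"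
    unfolding vertex_list_def by auto
qed

lemma char_poly_adj_matrix_wrt:
  fixes \<Gamma> :: "'a sgraph"
  assumes "distinct vs" "distinct ws" "set vs = set ws"
  shows "char_poly (adj_matrix_wrt \<Gamma> vs) = char_poly (adj_matrix_wrt \<Gamma> ws)"
proof -
  define n where "n = length vs"
  have len: "length ws = n" "length vs = n"
    using assms by (auto simp: n_def dest: distinct_card)
      (metis distinct_card)
  define P :: "'a list \<Rightarrow> 'a list \<Rightarrow> real mat"
    where "P = (\<lambda>xs ys. mat n n (\<lambda>(i, j). if xs ! i = ys ! j then 1 else 0))"
  have pos: "\<exists>k<n. ys ! k = x \<and> (\<forall>l<n. ys ! l = x \<longleftrightarrow> l = k)"
    if "distinct ys" "length ys = n" "x \<in> set ys" for x :: 'a and ys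
    using that by (metis in_set_conv_nth nth_eq_iff_index_eq)
  have PP: "P xs ys * P ys xs = 1\<^sub>m n"
    if h: "distinct xs" "distinct ys" "set xs = set ys" "length xs = n" "length ys = n" for xs ys :: "'a list"
  proof (rule eq_matI)
    fix i j assume ij: "i < dim_row (1\<^sub>m n :: real mat)" "j < dim_col (1\<^sub>m n :: real mat)"
    have "xs ! i \<in> set ys" using ij h by (metis index_one_mat(2) nth_mem)
    then obtain k where k: "k < n" "ys ! k = xs ! i" "\<forall>l<n. ys ! l = xs ! i \<longleftrightarrow> l = k"
      using pos[OF h(2) h(5)] by blast
    have "(P xs ys * P ys xs) $$ (i, j) =
        (\<Sum>l<n. (if xs ! i = ys ! l then 1 else 0) * (if ys ! l = xs ! j then 1 else 0))"
      using ij by (simp add: P_def scalar_prod_def atLeast0LessThan)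
    also have "\<dots> = (\<Sum>l<n. if l = k then (if ys ! l = xs ! j then 1 else 0) else 0)"
      using k by (intro sum.cong) auto
    also have "\<dots> = (if i = j then 1 else 0)"
      using k(1) ij h by (simp add: k(2) nth_eq_iff_index_eq)
    finally show "(P xs ys * P ys xs) $$ (i, j) = 1\<^sub>m n $$ (i, j)" using ij by simp
  qed (auto simp: P_def)
  have left: "adj_matrix_wrt \<Gamma> vs * P vs ws = P vs ws * adj_matrix_wrt \<Gamma> ws"
  proof (rule eq_matI)
    fix i j assume "i < dim_row (P vs ws * adj_matrix_wrt \<Gamma> ws)"
      and "j < dim_col (P vs ws * adj_matrix_wrt \<Gamma> ws)"
    then have ij: "i < n" "j < n" by (auto simp: P_def adj_matrix_wrt_def len)
    have "ws ! j \<in> set vs" "vs ! i \<in> set ws" using ij assms len by (metis nth_mem)+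
    then obtain k k' where k: "k < n" "vs ! k = ws ! j" "\<forall>l<n. vs ! l = ws ! j \<longleftrightarrow> l = k"
      and k': "k' < n" "ws ! k' = vs ! i" "\<forall>l<n. ws ! l = vs ! i \<longleftrightarrow> l = k'"
      using pos[OF assms(1) len(2)] pos[OF assms(2) len(1)] by metis
    have "(adj_matrix_wrt \<Gamma> vs * P vs ws) $$ (i, j) =
        (\<Sum>l<n. adj_entry \<Gamma> (vs ! i) (vs ! l) * (if vs ! l = ws ! j then 1 else 0))"
      using ij len by (simp add: P_def adj_matrix_wrt_def scalar_prod_def atLeast0LessThan)
    also have "\<dots> = (\<Sum>l<n. if l = k then adj_entry \<Gamma> (vs ! i) (vs ! l) else 0)"
      using k by (intro sum.cong) auto
    also have "\<dots> = adj_entry \<Gamma> (vs ! i) (ws ! j)" using k(1) by (simp add: k(2))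
    also have "\<dots> = (\<Sum>l<n. if l = k' then adj_entry \<Gamma> (ws ! l) (ws ! j) else 0)"
      using k'(1) by (simp add: k'(2))
    also have "\<dots> = (\<Sum>l<n. (if vs ! i = ws ! l then 1 else 0) * adj_entry \<Gamma> (ws ! l) (ws ! j))"
      using k' by (intro sum.cong) auto
    also have "\<dots> = (P vs ws * adj_matrix_wrt \<Gamma> ws) $$ (i, j)"
      using ij len by (simp add: P_def adj_matrix_wrt_def scalar_prod_def atLeast0LessThan)
    finally show "(adj_matrix_wrt \<Gamma> vs * P vs ws) $$ (i, j) =
        (P vs ws * adj_matrix_wrt \<Gamma> ws) $$ (i, j)" .
  qed (auto simp: P_def adj_matrix_wrt_def len)
  have c: "adj_matrix_wrt \<Gamma> vs \<in> carrier_mat n n" "adj_matrix_wrt \<Gamma> ws \<in> carrier_mat n n"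
    "P vs ws \<in> carrier_mat n n" "P ws vs \<in> carrier_mat n n"
    by (auto simp: P_def adj_matrix_wrt_def len)
  have inv: "P vs ws * P ws vs = 1\<^sub>m n" "P ws vs * P vs ws = 1\<^sub>m n"
    using PP assms len by auto
  have "P vs ws * adj_matrix_wrt \<Gamma> ws * P ws vs = adj_matrix_wrt \<Gamma> vs"
    unfolding left[symmetric] using c inv by (metis assoc_mult_mat right_mult_one_mat)
  then have "similar_mat (adj_matrix_wrt \<Gamma> vs) (adj_matrix_wrt \<Gamma> ws)"
    using c inv by (intro similar_matI[where P = "P vs ws" and Q = "P ws vs" and n = n]) auto
  then show ?thesis by (rule char_poly_similar)
qed

end

theory Submission
  imports Defs
begin

text \<open>The lower bound is a statement about orthogonal families on which the adjacency form is
  positive: by the spectral theorem, such a family has at most \<open>i\<^sub>+\<close> members. A family on an induced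
  subgraph is also a family on the whole graph, and a pendant vertex together with its neighbour
  contributes one further member to any family on the remaining vertices. These two facts suffice
  for an induction over connected induced subgraphs which shows \<open>2 i\<^sub>+ \<ge> n - p - 2\<theta>\<close>, with \<open>1\<close> gained
  on the right unless the graph is a cycle. A cycle has no pendant vertices and no two distinct
  cycles.\<close>

text \<open>The quantity \<open>n - p - 2 * theta\<close> is a sum over vertices of a function of
  the degree only as long as the graph has one component, so every deletion in the induction has to
  keep the graph connected. This is why a pendant vertex cannot always be taken out with its
  neighbour: in a star this would leave isolated vertices. If the neighbour has degree at least 3,
  the pendant vertex goes alone, and the drop in the neighbour's degree makes up for the lost
  vertex. The extra 1 has to be carried through the induction because some deletions are paid for
  only by the extra 1 of the smaller graph. It really fails for cycles: the all-positive 4-cycle has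
  eigenvalues 2, 0, 0, -2, so 2 * 1 = 4 - 0 - 2.\<close>

section \<open>Spectral decomposition of real symmetric matrices\<close>

text \<open>The reflection that swaps the first unit vector with \<open>u\<close>. It serves to
  complete an eigenvector to an orthonormal basis by an explicit, symmetric and involutive
  matrix.\<close>

lemma householder_reflection:
  fixes u :: "real vec"
  assumes u: "u \<in> carrier_vec n" and norm: "u \<bullet> u = 1" and n: "0 < n"
  obtains H where "H \<in> carrier_mat n n" "transpose_mat H = H" "H * H = 1\<^sub>m n" "col H 0 = u"
proof (cases "u $ 0 = 1")
  case True
  have "(\<Sum>i\<in>{0..<n} - {0}. u $ i * u $ i) = 0"
  proof -
    have "1 = (\<Sum>i\<in>{0..<n}. u $ i * u $ i)" using u norm by (simp add: scalar_prod_def)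
    also have "\<dots> = u $ 0 * u $ 0 + (\<Sum>i\<in>{0..<n} - {0}. u $ i * u $ i)"
      using n by (subst sum.remove[of _ 0]) auto
    finally show ?thesis using True by simp
  qed
  then have "\<forall>i\<in>{0..<n} - {0}. u $ i * u $ i = 0"
    by (subst (asm) sum_nonneg_eq_0_iff) auto
  then have "col (1\<^sub>m n) 0 = u"
    using u n True by (intro eq_vecI) auto
  then show ?thesis using that[of "1\<^sub>m n"] by auto
next
  case False
  \<comment> \<open>With \<open>w\<close> equal to \<open>u\<close> minus the first unit vector, the
    squared length of \<open>w\<close> is \<open>2 * c\<close>, so \<open>H\<close> below is the
    usual reflection I - 2 w w^T / (w . w). The other case is the degenerate one, \<open>w\<close> =
    0.\<close>
  define c where "c = 1 - u $ 0"
  have c: "c \<noteq> 0" using False by (simp add: c_def)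
  define w where "w i = u $ i - (if i = 0 then 1 else 0)" for i
  define H where "H = mat n n (\<lambda>(i, j). (if i = j then 1 else 0) - w i * w j / c)"
  have ww: "(\<Sum>k<n. w k * w k) = 2 * c"
  proof -
    have "(\<Sum>k<n. w k * w k) = (\<Sum>k<n. u $ k * u $ k + (if k = 0 then 1 - 2 * u $ 0 else 0))"
      by (intro sum.cong) (auto simp: w_def algebra_simps)
    also have "\<dots> = 2 * c"
      using u norm n by (simp add: sum.distrib scalar_prod_def c_def atLeast0LessThan)
    finally show ?thesis .
  qed
  have HH: "H * H = 1\<^sub>m n"
  proof (rule eq_matI)
    fix i j assume "i < dim_row (1\<^sub>m n :: real mat)" "j < dim_col (1\<^sub>m n :: real mat)"
    then have ij: "i < n" "j < n" by auto
    have "(H * H) $$ (i, j) = (\<Sum>k<n. ((if i = k then 1 else 0) - w i * w k / c) *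
        ((if k = j then 1 else 0) - w k * w j / c))"
      using ij by (simp add: H_def scalar_prod_def atLeast0LessThan)
    also have "\<dots> = (\<Sum>k<n. (if i = k then (if k = j then 1 else 0) - w i * w j / c else 0)
        - (if k = j then w i * w j / c else 0) + (w i * w j / (c * c)) * (w k * w k))"
      by (intro sum.cong) (auto simp: algebra_simps)
    also have "\<dots> = ((if i = j then 1 else 0) - w i * w j / c) - w i * w j / c
        + (w i * w j / (c * c)) * (2 * c)"
      using ij by (simp only: sum.distrib sum_subtractf sum_distrib_left[symmetric] ww)
        simp
    also have "\<dots> = 1\<^sub>m n $$ (i, j)" using c ij by (simp add: field_simps)
    finally show "(H * H) $$ (i, j) = 1\<^sub>m n $$ (i, j)" .
  qed (auto simp: H_def)
  have "col H 0 = u"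
  proof (rule eq_vecI)
    fix i assume "i < dim_vec u"
    then have i: "i < n" using u by simp
    have w0: "w 0 = - c" by (simp add: w_def c_def)
    show "col H 0 $ i = u $ i"
      using i n c by (simp add: H_def w0) (simp add: w_def c_def)
  qed (use u in \<open>simp add: H_def\<close>)
  moreover have "transpose_mat H = H" by (intro eq_matI) (auto simp: H_def mult.commute)
  ultimately show ?thesis using that[of H] HH by (simp add: H_def)
qed

text \<open>A complex eigenvalue \<open>z\<close> with eigenvector \<open>v\<close> exists by the
  fundamental theorem of algebra. The Hermitian form \<open>q\<close> of \<open>v\<close> is its own
  conjugate by symmetry and equals \<open>z\<close> times the squared length of \<open>v\<close>, so
  \<open>z\<close> is real.\<close>

lemma symmetric_mat_real_eigenvector:
  fixes A :: "real mat"
  assumes A: "A \<in> carrier_mat n n" and sym: "transpose_mat A = A" and n: "0 < n"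
  obtains u e where "u \<in> carrier_vec n" "u \<bullet> u = 1" "A *\<^sub>v u = e \<cdot>\<^sub>v u"
proof -
  let ?C = "map_mat complex_of_real A"
  have C: "?C \<in> carrier_mat n n" using A by simp
  have "degree (char_poly ?C) = n" using degree_monic_char_poly[OF C] by simp
  then have "\<not> constant (poly (char_poly ?C))" using n by (simp add: constant_degree)
  then obtain z where z: "poly (char_poly ?C) z = 0"
    using fundamental_theorem_of_algebra by blast
  then have "eigenvalue ?C z" using eigenvalue_root_char_poly[OF C] by simp
  then obtain v where v: "v \<in> carrier_vec n" "v \<noteq> 0\<^sub>v n" "?C *\<^sub>v v = z \<cdot>\<^sub>v v"
    using A by (auto simp: eigenvalue_def eigenvector_def)
  have row: "(\<Sum>b<n. of_real (A $$ (a, b)) * v $ b) = z * v $ a" if "a < n" for a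
  proof -
    have "(?C *\<^sub>v v) $ a = (\<Sum>b<n. of_real (A $$ (a, b)) * v $ b)"
      using that A v(1) by (simp add: scalar_prod_def atLeast0LessThan)
    moreover have "(?C *\<^sub>v v) $ a = z * v $ a" using v that by simp
    ultimately show ?thesis by simp
  qed
  define q where "q = (\<Sum>a<n. \<Sum>b<n. cnj (v $ a) * of_real (A $$ (a, b)) * v $ b)"
  have qz: "q = z * of_real (\<Sum>a<n. (cmod (v $ a))\<^sup>2)"
  proof -
    have "q = (\<Sum>a<n. cnj (v $ a) * (z * v $ a))"
      unfolding q_def using row by (simp add: mult.assoc sum_distrib_left[symmetric])
    then show ?thesis
      by (simp add: sum_distrib_left mult.left_commute mult.commute[of "cnj _"]
        flip: complex_norm_square)
  qed
  have symA: "A $$ (a, b) = A $$ (b, a)" if "a < n" "b < n" for a b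
    using that A sym by (metis carrier_matD index_transpose_mat(1))
  have "cnj q = (\<Sum>a<n. \<Sum>b<n. cnj (v $ b) * of_real (A $$ (b, a)) * v $ a)"
    unfolding q_def by (auto simp: mult_ac symA intro!: sum.cong)
  also have "\<dots> = q" unfolding q_def by (rule sum.swap)
  finally have "q \<in> \<real>" by (simp add: Reals_cnj_iff)
  moreover have pos: "(\<Sum>a<n. (cmod (v $ a))\<^sup>2) \<noteq> 0"
  proof
    assume "(\<Sum>a<n. (cmod (v $ a))\<^sup>2) = 0"
    then have "v = 0\<^sub>v n" using v(1) by (intro eq_vecI) (auto simp: sum_nonneg_eq_0_iff)
    then show False using v(2) by simp
  qed
  ultimately have "z \<in> \<real>"
    using qz by (metis Reals_divide Reals_of_real nonzero_mult_div_cancel_right of_real_eq_0_iff)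
  then obtain e where e: "z = of_real e" by (auto elim: Reals_cases)
  \<comment> \<open>The complex vector \<open>v\<close> is dropped here: a real root of the
    characteristic polynomial has a real eigenvector of its own.\<close>
  have "poly (char_poly A) e = 0"
    using z unfolding e of_real_hom.char_poly_hom[OF A] by simp
  then have "eigenvalue A e" using eigenvalue_root_char_poly[OF A] by simp
  then obtain x where x: "x \<in> carrier_vec n" "x \<noteq> 0\<^sub>v n" "A *\<^sub>v x = e \<cdot>\<^sub>v x"
    using A by (auto simp: eigenvalue_def eigenvector_def)
  have xx: "x \<bullet> x > 0"
  proof -
    have "(\<Sum>a<n. (x $ a)\<^sup>2) \<noteq> 0"
    proof
      assume "(\<Sum>a<n. (x $ a)\<^sup>2) = 0"
      then have "x = 0\<^sub>v n" using x(1) by (intro eq_vecI) (auto simp: sum_nonneg_eq_0_iff)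
      then show False using x(2) by simp
    qed
    moreover have "x \<bullet> x = (\<Sum>a<n. (x $ a)\<^sup>2)"
      using x by (simp add: scalar_prod_def atLeast0LessThan power2_eq_square)
    moreover have "(\<Sum>a<n. (x $ a)\<^sup>2) \<ge> 0" by (simp add: sum_nonneg)
    ultimately show ?thesis by simp
  qed
  define u where "u = (1 / sqrt (x \<bullet> x)) \<cdot>\<^sub>v x"
  show ?thesis
  proof
    show "u \<in> carrier_vec n" using x by (simp add: u_def)
    show "u \<bullet> u = 1" using x xx by (simp add: u_def)
    show "A *\<^sub>v u = e \<cdot>\<^sub>v u"
      using x A by (simp add: u_def mult_mat_vec smult_smult_assoc mult.commute)
  qed
qed

text \<open>Deflation: conjugating by the reflection that sends the first unit vector to an
  eigenvector clears the first column, by symmetry also the first row, and leaves a smaller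
  symmetric block. The sum of rank-one terms diagonalizes the quadratic form, and the factored
  characteristic polynomial ties the same coefficients \<open>d j\<close> to eigenvalue
  multiplicities.\<close>

lemma symmetric_mat_diagonalization:
  fixes A :: "real mat"
  assumes "A \<in> carrier_mat n n" "transpose_mat A = A"
  shows "\<exists>d W. (\<forall>a<n. \<forall>b<n. A $$ (a, b) = (\<Sum>j<n. d j * W j a * W j b)) \<and>
    char_poly A = (\<Prod>j<n. [:- d j, 1:])"
  using assms
proof (induction n arbitrary: A)
  case 0
  then have "char_poly A = 1"
    using degree_monic_char_poly[of A 0] by (metis monic_degree_0)
  then show ?case by simp
next
  case (Suc m)
  let ?n = "Suc m"
  note A = Suc.prems(1)
  obtain u e where u: "u \<in> carrier_vec ?n" "u \<bullet> u = 1" "A *\<^sub>v u = e \<cdot>\<^sub>v u"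
    using symmetric_mat_real_eigenvector[OF Suc.prems] by blast
  obtain H where H: "H \<in> carrier_mat ?n ?n" "transpose_mat H = H" "H * H = 1\<^sub>m ?n" "col H 0 = u"
    using householder_reflection[OF u(1,2)] by blast
  define B where "B = H * A * H"
  have B: "B \<in> carrier_mat ?n ?n" using H A by (simp add: B_def)
  have Bsym: "transpose_mat B = B"
    unfolding B_def using H A Suc.prems(2)
    by (subst transpose_mult[of _ ?n ?n _ ?n], simp_all)
      (subst transpose_mult[of _ ?n ?n _ ?n], simp_all add: assoc_mult_mat[of _ ?n ?n _ ?n _ ?n])
  have colB: "col B 0 = e \<cdot>\<^sub>v unit_vec ?n 0"
  proof -
    have "col B 0 = (H * A) *\<^sub>v col H 0"
      unfolding B_def using H A by (intro col_mult2[of _ ?n ?n _ ?n]) auto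
    also have "\<dots> = e \<cdot>\<^sub>v (H *\<^sub>v col H 0)"
      using H A u by (simp add: assoc_mult_mat_vec[of _ ?n ?n _ ?n] mult_mat_vec)
    also have "H *\<^sub>v col H 0 = col (H * H) 0"
      using H(1) by (intro col_mult2[symmetric, of _ ?n ?n _ ?n]) auto
    finally show ?thesis using H(3) by simp
  qed
  have B0: "B $$ (i, 0) = (if i = 0 then e else 0)" if "i < ?n" for i
  proof -
    have "B $$ (i, 0) = col B 0 $ i" using that B by simp
    then show ?thesis using that unfolding colB by simp
  qed
  have B0': "B $$ (0, i) = (if i = 0 then e else 0)" if "i < ?n" for i
    using B0[OF that] that B Bsym by (metis carrier_matD index_transpose_mat(1) zero_less_Suc)
  define A3 where "A3 = mat m m (\<lambda>(i, j). B $$ (Suc i, Suc j))"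
  have A3: "A3 \<in> carrier_mat m m" by (simp add: A3_def)
  have "transpose_mat A3 = A3"
  proof (rule eq_matI)
    fix i j assume "i < dim_row A3" "j < dim_col A3"
    then show "transpose_mat A3 $$ (i, j) = A3 $$ (i, j)"
      using B Bsym by (simp add: A3_def) (metis Suc_less_eq carrier_matD index_transpose_mat(1))
  qed (auto simp: A3_def)
  from Suc.IH[OF A3 this] obtain d W where
    dW: "\<And>a b. a < m \<Longrightarrow> b < m \<Longrightarrow> A3 $$ (a, b) = (\<Sum>j<m. d j * W j a * W j b)"
    and cp: "char_poly A3 = (\<Prod>j<m. [:- d j, 1:])"
    by blast
  let ?E = "mat 1 1 (\<lambda>_. e)"
  have Bblock: "B = four_block_mat ?E (0\<^sub>m 1 m) (0\<^sub>m m 1) A3"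
    using B by (intro eq_matI) (auto simp: A3_def B0 B0')
  have "char_poly ?E = [:- e, 1:]"
    by (subst char_poly_upper_triangular[of _ 1]) (auto simp: diag_mat_def)
  then have cpB: "char_poly B = [:- e, 1:] * char_poly A3"
    unfolding Bblock by (subst char_poly_four_block_zeros_col) (use A3 in auto)
  have HBH: "H * B * H = A"
  proof -
    have "H * B * H = (H * H) * A * (H * H)"
      unfolding B_def using H(1) A by (simp add: assoc_mult_mat[of _ ?n ?n _ ?n _ ?n])
    then show ?thesis using H A by simp
  qed
  have "similar_mat A B"
    using A B H HBH by (intro similar_matI[where P = H and Q = H and n = ?n]) auto
  then have cpA: "char_poly A = [:- e, 1:] * (\<Prod>j<m. [:- d j, 1:])"
    using char_poly_similar cpB cp by metis
  define d' where "d' = case_nat e d"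
  \<comment> \<open>Vectors for \<open>B\<close>: number 0 is the first unit vector, number
    \<open>Suc j\<close> is vector \<open>j\<close> of the block with a zero put in front.
    Multiplication by \<open>H\<close>, in \<open>W'\<close> below, turns them into vectors for
    \<open>A\<close>.\<close>
  define V :: "nat \<Rightarrow> nat \<Rightarrow> real"
    where "V j c = (case j of 0 \<Rightarrow> (if c = 0 then 1 else 0)
      | Suc j \<Rightarrow> (case c of 0 \<Rightarrow> 0 | Suc c \<Rightarrow> W j c))" for j c
  have Bsum: "B $$ (a, b) = (\<Sum>j<?n. d' j * V j a * V j b)" if "a < ?n" "b < ?n" for a b
  proof -
    have "(\<Sum>j<?n. d' j * V j a * V j b) =
        e * V 0 a * V 0 b + (\<Sum>j<m. d j * V (Suc j) a * V (Suc j) b)"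
      by (subst sum.lessThan_Suc_shift) (simp add: d'_def)
    also have "\<dots> = B $$ (a, b)"
    proof (cases a; cases b)
      fix a' b' assume ab: "a = Suc a'" "b = Suc b'"
      then have "B $$ (a, b) = A3 $$ (a', b')" using that by (simp add: A3_def)
      then show ?thesis using that ab dW[of a' b'] by (simp add: V_def)
    qed (use that in \<open>auto simp: V_def B0 B0'\<close>)
    finally show ?thesis ..
  qed
  define W' where "W' j a = (\<Sum>c<?n. H $$ (a, c) * V j c)" for j a
  have Hsym: "H $$ (a, b) = H $$ (b, a)" if "a < ?n" "b < ?n" for a b
    using that H by (metis carrier_matD index_transpose_mat(1))
  have "A $$ (a, b) = (\<Sum>j<?n. d' j * W' j a * W' j b)" if ab: "a < ?n" "b < ?n" for a b
  proof -
    have "A $$ (a, b) = (\<Sum>c<?n. H $$ (a, c) * (\<Sum>f<?n. B $$ (c, f) * H $$ (f, b)))"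
      using ab H B
      by (subst HBH[symmetric])
        (simp add: scalar_prod_def atLeast0LessThan assoc_mult_mat[of _ ?n ?n _ ?n _ ?n]
          del: sum.lessThan_Suc)
    also have "\<dots> = (\<Sum>c<?n. \<Sum>f<?n. \<Sum>j<?n. d' j * (H $$ (a, c) * V j c) * (H $$ (b, f) * V j f))"
      using ab by (auto simp: Bsum Hsym sum_distrib_left sum_distrib_right mult_ac
        intro!: sum.cong simp del: sum.lessThan_Suc)
    also have "\<dots> = (\<Sum>c<?n. \<Sum>j<?n. \<Sum>f<?n. d' j * (H $$ (a, c) * V j c) * (H $$ (b, f) * V j f))"
      by (intro sum.cong refl sum.swap)
    also have "\<dots> = (\<Sum>j<?n. \<Sum>c<?n. \<Sum>f<?n. d' j * (H $$ (a, c) * V j c) * (H $$ (b, f) * V j f))"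
      by (rule sum.swap)
    also have "\<dots> = (\<Sum>j<?n. d' j * W' j a * W' j b)"
      by (simp only: W'_def sum_distrib_left sum_distrib_right) (subst sum.swap, rule refl)
    finally show ?thesis .
  qed
  moreover have "char_poly A = (\<Prod>j<?n. [:- d' j, 1:])"
    unfolding cpA prod.lessThan_Suc_shift by (simp add: d'_def)
  ultimately show ?case by blast
qed

section \<open>Positive inertia bounded below by positive orthogonal families\<close>

lemma homogeneous_system_nontrivial_solution:
  fixes f :: "nat \<Rightarrow> nat \<Rightarrow> real"
  assumes J: "finite J" "card J < k"
  shows "\<exists>c. (\<exists>i<k. c i \<noteq> 0) \<and> (\<forall>j\<in>J. (\<Sum>i<k. f j i * c i) = 0)"
proof -
  define r where "r = card J"
  obtain h where h: "bij_betw h {0..<r} J"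
    using ex_bij_betw_nat_finite[OF J(1)] r_def by blast
  \<comment> \<open>The system is padded to a square one. Row \<open>r\<close> exists because
    \<open>r < k\<close>, and being zero it makes the determinant vanish; rows beyond
    \<open>r\<close> are arbitrary, since \<open>h\<close> is meaningful only below
    \<open>r\<close>.\<close>
  define M where "M = mat\<^sub>r k k (\<lambda>j. if j = r then 0\<^sub>v k else vec k (\<lambda>i. f (h j) i))"
  have M: "M \<in> carrier_mat k k" by (simp add: M_def)
  have "det M = 0"
    unfolding M_def using J(2) by (intro det_row_0) (auto simp: r_def)
  then obtain v where v: "v \<in> carrier_vec k" "v \<noteq> 0\<^sub>v k" "M *\<^sub>v v = 0\<^sub>v k"
    using det_0_iff_vec_prod_zero_field[OF M] by blast
  have "\<exists>i<k. v $ i \<noteq> 0"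
  proof (rule ccontr)
    assume "\<not> ?thesis"
    then have "v = 0\<^sub>v k" using v(1) by (intro eq_vecI) auto
    then show False using v(2) by simp
  qed
  moreover have "(\<Sum>i<k. f j i * v $ i) = 0" if "j \<in> J" for j
  proof -
    from that h obtain l where l: "l < r" "j = h l"
      by (auto simp: bij_betw_def)
    have "(M *\<^sub>v v) $ l = 0" using v(3) l J(2) by (simp add: r_def)
    then show ?thesis using l J(2) v(1) by (simp add: M_def r_def scalar_prod_def atLeast0LessThan)
  qed
  ultimately show ?thesis by (intro exI[of _ "\<lambda>i. v $ i"]) auto
qed

lemma order_prod_linear:
  fixes d :: "nat \<Rightarrow> real"
  shows "Polynomial.order x (\<Prod>j<n. [:- d j, 1:]) = card {j. j < n \<and> d j = x}"
proof (induction n)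
  case (Suc n)
  have "(\<Prod>j<n. [:- d j, 1:]) \<noteq> 0" by (simp add: prod_zero_iff)
  then have "Polynomial.order x (\<Prod>j<Suc n. [:- d j, 1:]) =
      card {j. j < n \<and> d j = x} + Polynomial.order x [:- d n, 1:]"
    unfolding prod.lessThan_Suc by (subst order_mult) (simp_all only: Suc mult_eq_0_iff, simp_all)
  also have "\<dots> = card {j. j < n \<and> d j = x} + (if d n = x then 1 else 0)"
    by (auto simp: order_linear')
  also have "\<dots> = card {j. j < Suc n \<and> d j = x}"
  proof -
    have "{j. j < Suc n \<and> d j = x} =
        (if d n = x then insert n {j. j < n \<and> d j = x} else {j. j < n \<and> d j = x})"
      by (auto simp: less_Suc_eq)
    then show ?thesis by simp
  qed
  finally show ?case .
qed simp

lemma pos_inertia_mat_eq: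
  assumes A: "A \<in> carrier_mat n n" and cp: "char_poly A = (\<Prod>j<n. [:- d j, 1:])"
  shows "pos_inertia_mat A = card {j. j < n \<and> d j > 0}"
proof -
  have ev: "eigenvalue A x \<longleftrightarrow> (\<exists>j<n. d j = x)" for x
    unfolding eigenvalue_root_char_poly[OF A] cp by (auto simp: poly_prod)
  let ?X = "{x. eigenvalue A x \<and> x > 0}"
  have X: "finite ?X" by (rule finite_subset[of _ "d ` {..<n}"]) (auto simp: ev)
  have "pos_inertia_mat A = (\<Sum>x\<in>?X. card {j. j < n \<and> d j = x})"
    unfolding pos_inertia_mat_def cp order_prod_linear ..
  also have "\<dots> = card (\<Union>x\<in>?X. {j. j < n \<and> d j = x})"
    using X by (intro card_UN_disjoint[symmetric]) auto
  also have "(\<Union>x\<in>?X. {j. j < n \<and> d j = x}) = {j. j < n \<and> d j > 0}"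
    by (auto simp: ev)
  finally show ?thesis .
qed

text \<open>The dimension count behind Sylvester's law of inertia. If the family outnumbered the
  positive coefficients, some nontrivial combination of it would be annihilated by every
  \<open>W j\<close> with \<open>d j > 0\<close>. The form would be at most 0 there, whereas
  orthogonality makes it a sum of squares with positive weights.\<close>

lemma pos_inertia_mat_ge:
  fixes A :: "real mat" and x :: "nat \<Rightarrow> nat \<Rightarrow> real"
  assumes A: "A \<in> carrier_mat n n" "transpose_mat A = A"
    and orth: "\<And>i j. i < k \<Longrightarrow> j < k \<Longrightarrow> i \<noteq> j \<Longrightarrow> (\<Sum>a<n. \<Sum>b<n. x i a * A $$ (a, b) * x j b) = 0"
    and pos: "\<And>i. i < k \<Longrightarrow> (\<Sum>a<n. \<Sum>b<n. x i a * A $$ (a, b) * x i b) > 0"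
  shows "k \<le> pos_inertia_mat A"
proof (rule ccontr)
  obtain d W where dW: "\<And>a b. a < n \<Longrightarrow> b < n \<Longrightarrow> A $$ (a, b) = (\<Sum>j<n. d j * W j a * W j b)"
    and cp: "char_poly A = (\<Prod>j<n. [:- d j, 1:])"
    using symmetric_mat_diagonalization[OF A] by blast
  define f where "f j i = (\<Sum>a<n. W j a * x i a)" for j i
  have form: "(\<Sum>a<n. \<Sum>b<n. x i a * A $$ (a, b) * x i' b) = (\<Sum>j<n. d j * f j i * f j i')" for i i'
  proof -
    have "(\<Sum>a<n. \<Sum>b<n. x i a * A $$ (a, b) * x i' b) =
        (\<Sum>a<n. \<Sum>b<n. \<Sum>j<n. d j * (W j a * x i a) * (W j b * x i' b))"
      by (auto simp: dW sum_distrib_left sum_distrib_right mult_ac intro!: sum.cong)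
    also have "\<dots> = (\<Sum>a<n. \<Sum>j<n. \<Sum>b<n. d j * (W j a * x i a) * (W j b * x i' b))"
      by (intro sum.cong refl sum.swap)
    also have "\<dots> = (\<Sum>j<n. \<Sum>a<n. \<Sum>b<n. d j * (W j a * x i a) * (W j b * x i' b))"
      by (rule sum.swap)
    also have "\<dots> = (\<Sum>j<n. d j * f j i * f j i')"
      by (simp only: f_def sum_distrib_left sum_distrib_right) (subst sum.swap, rule refl)
    finally show ?thesis .
  qed
  define P where "P = {j. j < n \<and> d j > 0}"
  assume "\<not> k \<le> pos_inertia_mat A"
  then have "card P < k" by (simp add: P_def pos_inertia_mat_eq[OF A(1) cp])
  then obtain c where c: "\<exists>i<k. c i \<noteq> 0" "\<forall>j\<in>P. (\<Sum>i<k. f j i * c i) = 0"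
    using homogeneous_system_nontrivial_solution[of P k f] by (auto simp: P_def)
  \<comment> \<open>The value of \<open>W j\<close> on the combination with coefficients
    \<open>c\<close>; it vanishes for \<open>j\<close> in \<open>P\<close>.\<close>
  define y where "y j = (\<Sum>i<k. f j i * c i)" for j
  have "(\<Sum>j<n. d j * (y j * y j)) = (\<Sum>j<n. \<Sum>i<k. \<Sum>i'<k. c i * c i' * (d j * f j i * f j i'))"
    unfolding y_def sum_product unfolding sum_distrib_left by (intro sum.cong refl) (simp only: mult_ac)
  also have "\<dots> = (\<Sum>i<k. \<Sum>j<n. \<Sum>i'<k. c i * c i' * (d j * f j i * f j i'))"
    by (rule sum.swap)
  also have "\<dots> = (\<Sum>i<k. \<Sum>i'<k. \<Sum>j<n. c i * c i' * (d j * f j i * f j i'))"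
    by (intro sum.cong refl sum.swap)
  also have "\<dots> = (\<Sum>i<k. \<Sum>i'<k. if i' = i then c i * c i * (\<Sum>j<n. d j * f j i * f j i) else 0)"
  proof (intro sum.cong refl)
    fix i i' assume "i \<in> {..<k}" "i' \<in> {..<k}"
    then show "(\<Sum>j<n. c i * c i' * (d j * f j i * f j i')) =
        (if i' = i then c i * c i * (\<Sum>j<n. d j * f j i * f j i) else 0)"
      using orth[of i i'] unfolding form by (simp add: sum_distrib_left[symmetric])
  qed
  also have "\<dots> = (\<Sum>i<k. (c i)\<^sup>2 * (\<Sum>j<n. d j * f j i * f j i))"
    by (simp add: power2_eq_square)
  also have "\<dots> > 0"
  proof -
    obtain i where "i < k" "c i \<noteq> 0" using c(1) by blast
    moreover have "0 \<le> (c i)\<^sup>2 * (\<Sum>j<n. d j * f j i * f j i)" if "i < k" for i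
      using pos[OF that] unfolding form by (intro mult_nonneg_nonneg) auto
    ultimately show ?thesis using pos unfolding form by (intro sum_pos2[of _ i]) auto
  qed
  finally have "(\<Sum>j<n. d j * (y j * y j)) > 0" .
  moreover have "(\<Sum>j<n. d j * (y j * y j)) \<le> 0"
  proof (rule sum_nonpos)
    fix j assume "j \<in> {..<n}"
    then show "d j * (y j * y j) \<le> 0"
      using c(2) by (cases "j \<in> P") (auto simp: P_def y_def mult_nonpos_nonneg)
  qed
  ultimately show False by simp
qed

section \<open>Connectedness and degrees of induced subgraphs, and the bound as a degree sum\<close>

text \<open>Signs and adjacency are merged into one weight, nonzero exactly on edges. An induced
  subgraph is then just a set of vertices, with the weight unchanged.\<close>

locale weighted_graph =
  fixes V :: "'a set" and w :: "'a \<Rightarrow> 'a \<Rightarrow> real"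
  assumes finite_V: "finite V"
    and w_sym: "w a b = w b a"
    and w_diag: "w a a = 0"
begin

definition nbrs :: "'a set \<Rightarrow> 'a \<Rightarrow> 'a set" where
  "nbrs S v = {u \<in> S. w v u \<noteq> 0}"

definition deg :: "'a set \<Rightarrow> 'a \<Rightarrow> nat" where
  "deg S v = card (nbrs S v)"

text \<open>For connected \<open>S\<close> this says that the induced graph is a cycle. In terms of
  degrees it is refuted by a single vertex, and no cyclic order has to be exhibited.\<close>

definition two_regular :: "'a set \<Rightarrow> bool" where
  "two_regular S \<longleftrightarrow> (\<forall>v\<in>S. deg S v = 2)"

lemma not_two_regularI: "v \<in> S \<Longrightarrow> deg S v \<noteq> 2 \<Longrightarrow> \<not> two_regular S"
  by (auto simp: two_regular_def)

text \<open>Connectedness by cuts instead of paths: inserting or deleting a vertex only requires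
  adjusting the cut, with no rerouting of paths.\<close>

definition conn :: "'a set \<Rightarrow> bool" where
  "conn S \<longleftrightarrow> S \<noteq> {} \<and> (\<forall>T. T \<subset> S \<longrightarrow> T \<noteq> {} \<longrightarrow> (\<exists>x\<in>T. \<exists>y\<in>S - T. w x y \<noteq> 0))"

lemma connE:
  assumes "conn S" "T \<subset> S" "T \<noteq> {}"
  obtains x y where "x \<in> T" "y \<in> S - T" "w x y \<noteq> 0"
  using assms unfolding conn_def by blast

lemma conn_insert:
  assumes S: "conn S" and y: "y \<in> S" "w x y \<noteq> 0"
  shows "conn (insert x S)"
  unfolding conn_def
proof (intro conjI allI impI)
  fix T assume T: "T \<subset> insert x S" "T \<noteq> {}"
  show "\<exists>a\<in>T. \<exists>b\<in>insert x S - T. w a b \<noteq> 0"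
  proof (cases "T \<inter> S = {} \<or> S \<subseteq> T")
    case True
    then show ?thesis
    proof
      assume "T \<inter> S = {}"
      then have "T = {x}" using T by blast
      then show ?thesis using y w_diag by force
    next
      assume "S \<subseteq> T"
      then have "x \<notin> T" using T by blast
      then show ?thesis using y w_sym[of x y] \<open>S \<subseteq> T\<close> by auto
    qed
  next
    case False
    then have "T \<inter> S \<subset> S" "T \<inter> S \<noteq> {}" by auto
    from connE[OF S this] show ?thesis by blast
  qed
qed auto

lemma conn_remove_pendant:
  assumes S: "conn S" and u: "u \<in> S" "nbrs S u = {v}"
  shows "conn (S - {u})"
  unfolding conn_def
proof (intro conjI allI impI)
  have v: "v \<in> S" "v \<noteq> u" using u(2) w_diag[of u] by (auto simp: nbrs_def)
  then show "S - {u} \<noteq> {}" by blast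
  fix T assume T: "T \<subset> S - {u}" "T \<noteq> {}"
  have nb: "y = v" if "w u y \<noteq> 0" "y \<in> S" for y using u(2) that by (auto simp: nbrs_def)
  show "\<exists>x\<in>T. \<exists>y\<in>S - {u} - T. w x y \<noteq> 0"
  proof (cases "v \<in> T")
    case True
    \<comment> \<open>Putting \<open>u\<close> on the side of \<open>v\<close> ensures that the edge
      across the cut does not start at \<open>u\<close>, whose only neighbour is
      \<open>v\<close>.\<close>
    have "insert u T \<subset> S" using T u by blast
    then obtain x y where xy: "x \<in> insert u T" "y \<in> S - insert u T" "w x y \<noteq> 0"
      by (rule connE[OF S]) auto
    then have "x \<noteq> u" using nb True by blast
    then show ?thesis using xy by blast
  next
    case False
    have "T \<subset> S" using T by blast
    then obtain x y where xy: "x \<in> T" "y \<in> S - T" "w x y \<noteq> 0"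
      using T by (metis connE[OF S])
    have "y \<noteq> u"
      using nb[of x] xy T False w_sym[of x y] by auto
    then show ?thesis using xy by blast
  qed
qed

text \<open>A maximal connected proper subset misses exactly one vertex, since adding any adjacent
  outside vertex keeps it connected.\<close>

lemma conn_ex_noncut:
  assumes "finite S" "conn S" "card S \<ge> 2"
  shows "\<exists>v\<in>S. conn (S - {v})"
proof -
  define F where "F = {T. T \<subset> S \<and> conn T}"
  have "finite F" using assms(1) by (auto simp: F_def intro: finite_subset[of _ "Pow S"])
  obtain a where a: "a \<in> S" using assms(2) by (auto simp: conn_def)
  have "{a} \<noteq> S" using assms(3) by auto
  moreover have "conn {a}" by (auto simp: conn_def)
  ultimately have "{a} \<in> F" using a by (auto simp: F_def)
  then obtain T where T: "T \<in> F" "\<And>T'. T' \<in> F \<Longrightarrow> T \<subseteq> T' \<Longrightarrow> T' = T"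
    using finite_has_maximal[OF \<open>finite F\<close>] by (metis emptyE)
  then have TS: "T \<subset> S" "conn T" by (auto simp: F_def)
  then have "T \<noteq> {}" by (auto simp: conn_def)
  then obtain x y where xy: "x \<in> T" "y \<in> S - T" "w x y \<noteq> 0"
    using connE[OF assms(2) TS(1)] by blast
  have "conn (insert y T)" using conn_insert[OF TS(2) xy(1)] xy(3) w_sym by metis
  moreover have "insert y T \<noteq> T" using xy by blast
  ultimately have "insert y T = S"
    using T(2)[of "insert y T"] TS xy(2) by (auto simp: F_def)
  then have "S - {y} = T" using xy(2) by blast
  then show ?thesis using TS(2) xy(2) by auto
qed

lemma deg_Diff:
  assumes "finite S" "v \<in> S"
  shows "deg (S - {v}) x = deg S x - (if w x v \<noteq> 0 then 1 else 0)"
proof -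
  have "nbrs (S - {v}) x = nbrs S x - {v}" by (auto simp: nbrs_def)
  then show ?thesis using assms by (auto simp: deg_def nbrs_def)
qed

lemma deg_pos_of_conn:
  assumes "finite S" "conn S" "card S \<ge> 2" "v \<in> S"
  shows "deg S v \<ge> 1"
proof -
  have "{v} \<noteq> S" using assms(3) by auto
  then have "{v} \<subset> S" using assms(4) by blast
  from connE[OF assms(2) this] obtain y where "y \<in> nbrs S v" by (auto simp: nbrs_def)
  moreover have "finite (nbrs S v)" using assms(1) by (auto simp: nbrs_def)
  ultimately show ?thesis unfolding deg_def by (metis One_nat_def Suc_leI card_gt_0_iff empty_iff)
qed

text \<open>Removing one degree-2 vertex turns a neighbour of degree 2 into a pendant vertex, which can
  be removed as well, after which the first vertex is reattached through its other neighbour.\<close>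

lemma noncut_neighbour:
  assumes S: "finite S" and v: "v \<in> S" "conn (S - {v})" "deg S v = 2"
    and x: "x \<in> nbrs S v" "deg S x = 2"
  shows "conn (S - {x})"
proof -
  have xS: "x \<in> S" "w v x \<noteq> 0" "x \<noteq> v" using x(1) w_diag by (auto simp: nbrs_def)
  have "nbrs S v \<noteq> {x}" using v(3) by (auto simp: deg_def)
  then obtain y where "y \<in> nbrs S v" "y \<noteq> x" using x(1) by blast
  then have y: "y \<in> S" "w v y \<noteq> 0" "y \<noteq> x" by (auto simp: nbrs_def)
  have yv: "y \<noteq> v" using y(2) w_diag by auto
  have "deg (S - {v}) x = 1"
    using deg_Diff[OF S v(1), of x] x(2) xS(2) w_sym[of x v] by simp
  then obtain z where "nbrs (S - {v}) x = {z}" by (auto simp: deg_def card_1_singleton_iff)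
  then have "conn (S - {v} - {x})"
    using conn_remove_pendant[OF v(2), of x z] xS by blast
  then have "conn (insert v (S - {v} - {x}))"
    by (rule conn_insert[where y = y]) (use y yv in auto)
  moreover have "insert v (S - {v} - {x}) = S - {x}" using v(1) xS(3) by blast
  ultimately show ?thesis by simp
qed

text \<open>Under the degree condition, being removable passes along every edge by
  \<open>noncut_neighbour\<close>, and it holds somewhere by \<open>conn_ex_noncut\<close>. It is
  used directly for cycles, and contrapositively to find a removable vertex that has degree other
  than 2 or such a neighbour.\<close>

lemma noncut_all:
  assumes S: "finite S" "conn S" "card S \<ge> 2"
    and reg: "\<And>v x. v \<in> S \<Longrightarrow> conn (S - {v}) \<Longrightarrow>
      deg S v = 2 \<and> (\<forall>x\<in>nbrs S v. deg S x = 2)"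
  shows "\<And>v. v \<in> S \<Longrightarrow> conn (S - {v})"
proof -
  define X where "X = {v \<in> S. conn (S - {v})}"
  have "X \<noteq> {}" using conn_ex_noncut[OF S] by (auto simp: X_def)
  have "X = S"
  proof (rule ccontr)
    assume "X \<noteq> S"
    then have "X \<subset> S" by (auto simp: X_def)
    then obtain x y where xy: "x \<in> X" "y \<in> S - X" "w x y \<noteq> 0"
      by (rule connE[OF S(2) _ \<open>X \<noteq> {}\<close>])
    then have "x \<in> S" "conn (S - {x})" "y \<in> nbrs S x" by (auto simp: X_def nbrs_def)
    then have "conn (S - {y})"
      using reg[of x] xy(2) noncut_neighbour[OF S(1), of x y] by (auto simp: nbrs_def)
    then show False using xy by (auto simp: X_def)
  qed
  moreover have "conn (S - {v})" if "v \<in> X" for v using that by (simp add: X_def)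
  ultimately show "\<And>v. v \<in> S \<Longrightarrow> conn (S - {v})" by blast
qed

text \<open>Summed over the vertices and decreased by 2, \<open>contrib\<close> gives \<open>n - p - 2\<theta>\<close> for a
  connected graph, since the degrees minus 2 sum up to \<open>2\<theta> - 2\<close>.\<close>

definition contrib :: "nat \<Rightarrow> int" where
  "contrib d = 3 - int d - (if d = 1 then 1 else 0)"

definition bound :: "'a set \<Rightarrow> int" where
  "bound S = (\<Sum>v\<in>S. contrib (deg S v)) - 2"

text \<open>Losing one neighbour raises \<open>contrib\<close> by 1 from degree 3 upwards, but
  \<open>contrib 2 = contrib 1\<close>: there the new pendant vertex cancels the gain. Hence only
  neighbours of degree at least 3 are counted. A pendant neighbour would become isolated and change
  \<open>contrib\<close> by 2, which the hypothesis on degrees excludes.\<close>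

lemma bound_Diff:
  assumes S: "finite S" "v \<in> S" and nb: "\<And>x. x \<in> nbrs S v \<Longrightarrow> deg S x \<ge> 2"
  shows "bound (S - {v}) =
    bound S - contrib (deg S v) + int (card {x \<in> nbrs S v. deg S x \<ge> 3})"
proof -
  let ?P = "\<lambda>x. x \<in> nbrs S v \<and> deg S x \<ge> 3"
  have step: "contrib (deg (S - {v}) x) = contrib (deg S x) + (if ?P x then 1 else 0)"
    if x: "x \<in> S - {v}" for x
  proof (cases "x \<in> nbrs S v")
    case True
    then have "deg (S - {v}) x = deg S x - 1"
      using deg_Diff[OF S, of x] w_sym[of x v] by (simp add: nbrs_def)
    then show ?thesis using nb[OF True] True by (auto simp: contrib_def)
  next
    case False
    then have "deg (S - {v}) x = deg S x"
      using deg_Diff[OF S, of x] w_sym[of x v] x by (simp add: nbrs_def)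
    then show ?thesis using False by simp
  qed
  have "(\<Sum>x\<in>S - {v}. contrib (deg (S - {v}) x)) =
      (\<Sum>x\<in>S - {v}. contrib (deg S x) + (if ?P x then 1 else 0))"
    by (rule sum.cong[OF refl step])
  also have "\<dots> = (\<Sum>x\<in>S - {v}. contrib (deg S x)) + (\<Sum>x\<in>S - {v}. if ?P x then 1 else 0)"
    by (rule sum.distrib)
  also have "(\<Sum>x\<in>S - {v}. if ?P x then 1 else 0) = (\<Sum>x | x \<in> S - {v} \<and> ?P x. 1 :: int)"
    by (rule sum.inter_filter[symmetric]) (use S in simp)
  also have "{x. x \<in> S - {v} \<and> ?P x} = {x \<in> nbrs S v. deg S x \<ge> 3}"
    using w_diag by (auto simp: nbrs_def)
  finally show ?thesis
    using sum.remove[OF S, of "\<lambda>x. contrib (deg S x)"] by (simp add: bound_def)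
qed

section \<open>The adjacency form and families on which it is positive\<close>

definition bil :: "('a \<Rightarrow> real) \<Rightarrow> ('a \<Rightarrow> real) \<Rightarrow> real" where
  "bil x y = (\<Sum>a\<in>V. \<Sum>b\<in>V. x a * w a b * y b)"

definition unit :: "'a \<Rightarrow> 'a \<Rightarrow> real" where
  "unit v = (\<lambda>a. if a = v then 1 else 0)"

lemma bil_sym: "bil x y = bil y x"
  unfolding bil_def
  by (subst sum.swap) (intro sum.cong refl, simp only: w_sym mult_ac)

lemma bil_add_right: "bil x (\<lambda>a. y a + c * z a) = bil x y + c * bil x z"
  by (simp add: bil_def algebra_simps sum.distrib sum_distrib_left)

lemma bil_add_left: "bil (\<lambda>a. y a + c * z a) x = bil y x + c * bil z x"
  unfolding bil_sym[of _ x] by (rule bil_add_right)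

lemma bil_unit:
  assumes "v \<in> V"
  shows "bil (unit v) y = (\<Sum>b\<in>V. w v b * y b)"
proof -
  have "bil (unit v) y = (\<Sum>a\<in>V. if a = v then \<Sum>b\<in>V. w v b * y b else 0)"
    unfolding bil_def unit_def by (intro sum.cong) auto
  then show ?thesis using finite_V assms by simp
qed

lemma bil_unit_unit:
  assumes "u \<in> V" "v \<in> V"
  shows "bil (unit u) (unit v) = w u v"
proof -
  have "bil (unit u) (unit v) = (\<Sum>b\<in>V. if b = v then w u v else 0)"
    unfolding bil_unit[OF assms(1)] by (intro sum.cong) (auto simp: unit_def)
  then show ?thesis using finite_V assms(2) by simp
qed

text \<open>Such a family spans a positive definite subspace of dimension \<open>k\<close>. Its
  members are functions on all vertices with support in \<open>S\<close>, so that enlarging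
  \<open>S\<close> leaves both the family and the form untouched.\<close>

definition pos_family :: "'a set \<Rightarrow> nat \<Rightarrow> bool" where
  "pos_family S k \<longleftrightarrow> (\<exists>x. (\<forall>i<k. \<forall>a. a \<notin> S \<longrightarrow> x i a = 0) \<and>
     (\<forall>i<k. \<forall>j<k. i \<noteq> j \<longrightarrow> bil (x i) (x j) = 0) \<and> (\<forall>i<k. bil (x i) (x i) > 0))"

lemma pos_family_0: "pos_family S 0"
  by (simp add: pos_family_def)

lemma pos_family_mono:
  assumes "pos_family S k" "S \<subseteq> T"
  shows "pos_family T k"
proof -
  obtain x where x: "(\<forall>i<k. \<forall>a. a \<notin> S \<longrightarrow> x i a = 0) \<and>
     (\<forall>i<k. \<forall>j<k. i \<noteq> j \<longrightarrow> bil (x i) (x j) = 0) \<and> (\<forall>i<k. bil (x i) (x i) > 0)"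
    using assms(1) unfolding pos_family_def by (rule exE)
  show ?thesis
    unfolding pos_family_def by (rule exI[of _ x]) (use x assms(2) in auto)
qed

text \<open>The family is made orthogonal to the pendant pair by adding multiples of the unit vector of
  the pendant vertex, which is isotropic and orthogonal to everything supported on \<open>S\<close>.\<close>

lemma pos_family_pendant:
  assumes fam: "pos_family S k" and S: "S \<subseteq> V"
    and uv: "u \<in> V" "v \<in> V" "w u v \<noteq> 0" and u: "\<And>x. x \<in> S \<Longrightarrow> w u x = 0"
  shows "pos_family (insert u (insert v S)) (Suc k)"
proof -
  obtain x where x: "(\<forall>i<k. \<forall>a. a \<notin> S \<longrightarrow> x i a = 0) \<and>
     (\<forall>i<k. \<forall>j<k. i \<noteq> j \<longrightarrow> bil (x i) (x j) = 0) \<and> (\<forall>i<k. bil (x i) (x i) > 0)"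
    using fam unfolding pos_family_def by (rule exE)
  have supp: "\<And>i a. i < k \<Longrightarrow> a \<notin> S \<Longrightarrow> x i a = 0"
    and orth: "\<And>i j. i < k \<Longrightarrow> j < k \<Longrightarrow> i \<noteq> j \<Longrightarrow> bil (x i) (x j) = 0"
    and pos: "\<And>i. i < k \<Longrightarrow> bil (x i) (x i) > 0"
    using x by auto
  \<comment> \<open>The coefficient that makes \<open>x' i\<close> orthogonal to
    \<open>unit v\<close>; adding a multiple of \<open>unit u\<close> changes no product within the
    family.\<close>
  define c where "c i = - bil (unit v) (x i) / w u v" for i
  define x' where "x' i = (\<lambda>a. x i a + c i * unit u a)" for i
  \<comment> \<open>The factor \<open>w u v\<close> matches the sign of the edge, so the form at
    \<open>z\<close> is \<open>2 * (w u v)^2\<close>, positive for negative edges too.\<close>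
  define z where "z = (\<lambda>a. unit v a + w u v * unit u a)"
  have ux: "bil (unit u) (x i) = 0" if "i < k" for i
    unfolding bil_unit[OF uv(1)] using u supp[OF that] by (intro sum.neutral) auto
  have xu: "bil (x i) (unit u) = 0" "bil (x i) (unit v) = bil (unit v) (x i)" if "i < k" for i
    using ux[OF that] by (simp_all add: bil_sym[of "x i" "unit u"] bil_sym[of "x i" "unit v"])
  have units: "bil (unit u) (unit u) = 0" "bil (unit v) (unit v) = 0"
    "bil (unit u) (unit v) = w u v" "bil (unit v) (unit u) = w u v"
    by (simp_all add: bil_unit_unit uv w_diag w_sym[of v u])
  have xx: "bil (x' i) (x' j) = bil (x i) (x j)" if "i < k" "j < k" for i j
    unfolding x'_def bil_add_left bil_add_right
    using ux[OF that(1)] ux[OF that(2)] xu[OF that(1)] units by simp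
  have xz: "bil (x' i) z = 0" if "i < k" for i
    unfolding x'_def z_def bil_add_left bil_add_right
    using xu[OF that] uv(3) units by (simp add: c_def)
  then have zx: "bil z (x' i) = 0" if "i < k" for i using that bil_sym[of z] by simp
  have "bil z z = 2 * (w u v)\<^sup>2"
    unfolding z_def bil_add_left bil_add_right units by (simp add: power2_eq_square)
  then have zz: "bil z z > 0" using uv(3) by simp
  define y where "y i = (if i < k then x' i else z)" for i
  show ?thesis
    unfolding pos_family_def
  proof (intro exI[of _ y] conjI allI impI)
    fix i a assume "a \<notin> insert u (insert v S)"
    then show "y i a = 0" using supp by (auto simp: y_def x'_def z_def unit_def)
  next
    fix i j assume "i < Suc k" "j < Suc k" "i \<noteq> j"
    then show "bil (y i) (y j) = 0"
      using xx xz zx orth by (auto simp: y_def less_Suc_eq)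
  next
    fix i assume "i < Suc k"
    then show "bil (y i) (y i) > 0" using xx zz pos by (auto simp: y_def)
  qed
qed

lemma pos_family_remove_pendant:
  assumes S: "S \<subseteq> V" and u: "u \<in> S" "nbrs S u = {v}" and fam: "pos_family (S - {u} - {v}) k"
  shows "pos_family S (Suc k)"
proof -
  have v: "v \<in> S" "w u v \<noteq> 0" using u(2) by (auto simp: nbrs_def)
  have "pos_family (insert u (insert v (S - {u} - {v}))) (Suc k)"
    by (rule pos_family_pendant[OF fam]) (use S u v in \<open>auto simp: nbrs_def\<close>)
  moreover have "insert u (insert v (S - {u} - {v})) = S" using u v by blast
  ultimately show ?thesis by simp
qed

text \<open>Induction on the number of vertices. A pendant vertex is removed together with its
  neighbour if the latter has degree 2 (or if only a cycle would be left), and on its own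
  otherwise. Without pendant vertices any vertex that does not disconnect the graph can be removed,
  and the bound improves unless that vertex and both its neighbours have degree 2.\<close>

theorem ex_pos_family:
  assumes "S \<subseteq> V" "conn S" "card S \<ge> 2"
  shows "\<exists>k. pos_family S k \<and> 2 * int k \<ge> bound S + (if two_regular S then 0 else 1)"
  using assms
proof (induction "card S" arbitrary: S rule: less_induct)
  case less
  note SV = \<open>S \<subseteq> V\<close> and conn = \<open>conn S\<close> and card = \<open>2 \<le> card S\<close>
  have fin: "finite S" using SV finite_V finite_subset by blast
  have deg1: "deg S v \<ge> 1" if "v \<in> S" for v using deg_pos_of_conn[OF fin conn card that] .
  have fin_nb: "finite (nbrs T v)" if "T \<subseteq> S" for T v
    using fin that finite_subset[of T S] by (auto simp: nbrs_def)
  have IH: "\<exists>k. pos_family T k \<and> 2 * int k \<ge> bound T + (if two_regular T then 0 else 1)"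
    if "T \<subset> S" "conn T" "card T \<ge> 2" for T
    using less.hyps[of T] that SV psubset_card_mono[OF fin that(1)] by auto
  show ?case
  proof (cases "\<exists>u\<in>S. deg S u = 1")
    case True
    then obtain u where u: "u \<in> S" "deg S u = 1" by blast
    then obtain v where nu: "nbrs S u = {v}" by (auto simp: deg_def card_1_singleton_iff)
    have v: "v \<in> S" "w u v \<noteq> 0" "v \<noteq> u" using nu w_diag[of u] by (auto simp: nbrs_def)
    have nreg: "\<not> two_regular S" using u by (intro not_two_regularI[of u]) auto
    let ?S1 = "S - {u}" and ?S2 = "S - {u} - {v}"
    have conn1: "conn ?S1" using conn_remove_pendant[OF conn u(1) nu] .
    have fin1: "finite ?S1" using fin by simp
    have v1: "v \<in> ?S1" using v by blast
    have d1: "deg ?S1 x = deg S x - (if x = v then 1 else 0)" if "x \<in> S" for x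
      using deg_Diff[OF fin u(1), of x] nu that w_sym[of x u] by (auto simp: nbrs_def)
    have two: ?thesis if "card S = 2"
    proof -
      have "S = {u, v}" using u v that fin card_subset_eq[of S "{u, v}"] by simp
      moreover have "nbrs S v = {u}" using \<open>S = {u, v}\<close> w_sym[of u v] v w_diag by (auto simp: nbrs_def)
      ultimately have "bound S = 0"
        using u(2) v(3) by (simp add: bound_def contrib_def deg_def)
      then show ?thesis
        using pos_family_remove_pendant[OF SV u(1) nu pos_family_0] nreg by (intro exI[of _ 1]) auto
    qed
    have degv: "deg S v \<ge> 2" if "card S \<ge> 3"
    proof -
      have "card ?S1 \<ge> 2" using that u(1) fin by simp
      from deg_pos_of_conn[OF fin1 conn1 this v1] show ?thesis using d1[OF v(1)] by simp
    qed
    \<comment> \<open>The split at four vertices guarantees that at least two are left once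
      \<open>u\<close> and \<open>v\<close> are gone, as the induction hypothesis requires; the
      smaller graphs are paths and are computed directly.\<close>
    consider "card S = 2" | (three) "card S = 3" | (pair) "card S \<ge> 4" "deg S v = 2"
      | (single) "card S \<ge> 4" "deg S v \<ge> 3"
      using card degv by linarith
    then show ?thesis
    proof cases
      case 1
      then show ?thesis by (rule two)
    next
      case three
      have "card ?S2 = 1" using three u(1) v fin by simp
      then obtain z where z: "?S2 = {z}" by (auto simp: card_1_singleton_iff)
      then have S: "S = {u, v, z}" and ne: "z \<noteq> u" "z \<noteq> v" using u v by auto
      have "z \<notin> nbrs S u" using nu ne by simp
      then have "w z u = 0" using S w_sym[of u z] by (simp add: nbrs_def)
      have "nbrs S z \<subseteq> {v}"
      proof
        fix y assume "y \<in> nbrs S z"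
        then have "y \<in> {u, v, z}" "w z y \<noteq> 0" unfolding S[symmetric] by (simp_all add: nbrs_def)
        then show "y \<in> {v}" using \<open>w z u = 0\<close> w_diag[of z] by auto
      qed
      then have "deg S z \<le> 1" using card_mono[of "{v}" "nbrs S z"] by (simp add: deg_def)
      then have z1: "deg S z = 1" using deg1[of z] S by simp
      have "nbrs S v \<subseteq> {u, z}" using S w_diag by (auto simp: nbrs_def)
      then have "deg S v \<le> card {u, z}" unfolding deg_def by (intro card_mono) auto
      then have "deg S v = 2" using degv three ne by simp
      moreover have "bound S = contrib (deg S u) + contrib (deg S v) + contrib (deg S z) - 2"
        using ne v(3) unfolding bound_def by (subst (1) S) simp
      ultimately have "bound S = 1" using u(2) z1 by (simp add: contrib_def)
      then show ?thesis
        using pos_family_remove_pendant[OF SV u(1) nu pos_family_0] nreg by (intro exI[of _ 1]) auto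
    next
      case pair
      have v1d: "deg ?S1 v = 1" using d1[OF v(1)] pair by simp
      then obtain z where z: "nbrs ?S1 v = {z}" by (auto simp: deg_def card_1_singleton_iff)
      have conn2: "conn ?S2" using conn_remove_pendant[OF conn1 v1 z] .
      have card2: "card ?S2 \<ge> 2" using pair(1) u(1) v fin by simp
      have "z \<in> nbrs ?S1 v" using z by simp
      then have zS: "z \<in> ?S2" "w z v \<noteq> 0"
        using w_diag[of v] w_sym[of v z] by (auto simp: nbrs_def)
      have dz: "deg ?S2 z = deg ?S1 z - 1" using deg_Diff[OF fin1 v1, of z] zS by simp
      \<comment> \<open>A pendant \<open>z\<close> in \<open>?S1\<close> would be isolated in the
        connected \<open>?S2\<close>; this supplies the degree hypothesis of
        \<open>bound_Diff\<close>.\<close>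
      have dz2: "deg ?S1 z \<ge> 2" using deg_pos_of_conn[OF _ conn2 card2 zS(1)] fin dz by simp
      have b1: "bound ?S1 = bound S - 1"
        using bound_Diff[OF fin u(1)] nu pair u(2) by (simp add: contrib_def)
      have b2: "bound ?S2 = bound ?S1 - 1 + int (card {x \<in> {z}. deg ?S1 x \<ge> 3})"
        using bound_Diff[OF fin1 v1] z dz2 v1d by (simp add: contrib_def)
      obtain k where k: "pos_family ?S2 k"
        "2 * int k \<ge> bound ?S2 + (if two_regular ?S2 then 0 else 1)"
        using IH[OF _ conn2 card2] u(1) by blast
      \<comment> \<open>The pair will add 2 to the left side, so \<open>bound S - 1\<close> suffices
        for \<open>bound S + 1\<close>. Deleting both vertices costs 2, or 1 if \<open>z\<close> has
        degree at least 3 in \<open>?S1\<close>. Otherwise \<open>z\<close> is pendant in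
        \<open>?S2\<close>, which is then no cycle, and the induction hypothesis returns the missing
        1.\<close>
      have "2 * int k \<ge> bound S - 1"
      proof (cases "deg ?S1 z \<ge> 3")
        case True
        then have "{x \<in> {z}. deg ?S1 x \<ge> 3} = {z}" by auto
        then show ?thesis using k(2) b1 b2 by (simp split: if_splits)
      next
        case False
        then have "deg ?S2 z = 1" using dz dz2 by simp
        then have "\<not> two_regular ?S2" using zS(1) by (intro not_two_regularI[of z]) auto
        then show ?thesis using k(2) b1 b2 by simp
      qed
      then show ?thesis
        using pos_family_remove_pendant[OF SV u(1) nu k(1)] nreg by (intro exI[of _ "Suc k"]) simp
    next
      case single
      \<comment> \<open>The lost pendant vertex costs 1 and the lowered degree of \<open>v\<close>
        gives 1 back, so the bound is unchanged.\<close>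
      have "{x \<in> nbrs S u. deg S x \<ge> 3} = {v}" using nu single by auto
      then have b1: "bound ?S1 = bound S"
        using bound_Diff[OF fin u(1)] nu single u(2) by (simp add: contrib_def)
      have card1: "card ?S1 \<ge> 2" using single(1) u(1) fin by simp
      show ?thesis
      proof (cases "two_regular ?S1")
        case False
        then obtain k where "pos_family ?S1 k" "2 * int k \<ge> bound ?S1 + 1"
          using IH[OF _ conn1 card1] u(1) by auto
        then show ?thesis using b1 nreg pos_family_mono[of ?S1 k S] by auto
      next
        \<comment> \<open>A cycle offers no extra 1. Deleting \<open>v\<close> as well leaves a
          connected graph at the cost of 1, while the pair \<open>u\<close>, \<open>v\<close>
          contributes 2 to the left side.\<close>
        case True
        have reg: "deg ?S1 x = 2" if "x \<in> ?S1" for x using True that by (simp add: two_regular_def)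
        have conn2: "conn ?S2"
          by (rule noncut_all[OF fin1 conn1 card1 _ v1]) (use reg in \<open>auto simp: nbrs_def\<close>)
        have card2: "card ?S2 \<ge> 2" using single(1) u(1) v fin by simp
        have "{x \<in> nbrs ?S1 v. deg ?S1 x \<ge> 3} = {}" (is "?N = {}") using reg by (auto simp: nbrs_def)
        moreover have "bound ?S2 = bound ?S1 - contrib (deg ?S1 v)
            + int (card ?N)"
          by (rule bound_Diff[OF fin1 v1]) (use reg in \<open>auto simp: nbrs_def\<close>)
        ultimately have b2: "bound ?S2 = bound ?S1 - 1"
          using reg[OF v1] by (simp only: contrib_def) simp
        obtain k where k: "pos_family ?S2 k"
          "2 * int k \<ge> bound ?S2 + (if two_regular ?S2 then 0 else 1)"
          using IH[OF _ conn2 card2] u(1) by blast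
        then have "2 * int k \<ge> bound S - 1" using b1 b2 by (simp split: if_splits)
        then show ?thesis
          using pos_family_remove_pendant[OF SV u(1) nu k(1)] nreg by (intro exI[of _ "Suc k"]) simp
      qed
    qed
  next
    case False
    then have deg2: "deg S x \<ge> 2" if "x \<in> S" for x using deg1[OF that] that by force
    \<comment> \<open>In a cycle any removable vertex will do; otherwise \<open>noncut_all\<close>
      yields one for which the premises of \<open>v2\<close> fail.\<close>
    obtain v where v: "v \<in> S" "conn (S - {v})"
      and v2: "deg S v = 2 \<Longrightarrow> \<forall>x\<in>nbrs S v. deg S x = 2 \<Longrightarrow> two_regular S"
    proof (cases "two_regular S")
      case True
      then show ?thesis using conn_ex_noncut[OF fin conn card] that by blast
    next
      case False
      have "\<exists>v\<in>S. conn (S - {v}) \<and> \<not> (deg S v = 2 \<and> (\<forall>x\<in>nbrs S v. deg S x = 2))"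
      proof (rule ccontr)
        assume *: "\<not> ?thesis"
        then have "conn (S - {v})" if "v \<in> S" for v
          using noncut_all[OF fin conn card] that by blast
        with * have "two_regular S" by (auto simp: two_regular_def)
        then show False using False by simp
      qed
      then show ?thesis using that by blast
    qed
    define t where "t = card {x \<in> nbrs S v. deg S x \<ge> 3}"
    have finN: "finite (nbrs S v)" using fin by (auto simp: nbrs_def)
    have "nbrs S v \<subseteq> S - {v}" using w_diag by (auto simp: nbrs_def)
    then have "deg S v \<le> card (S - {v})" unfolding deg_def using fin by (intro card_mono) auto
    then have card': "card (S - {v}) \<ge> 2" using deg2[OF v(1)] by simp
    have "contrib (deg S v) = 3 - int (deg S v)" using deg2[OF v(1)] by (simp add: contrib_def)
    then have b: "bound (S - {v}) = bound S - 3 + int (deg S v) + int t"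
      using bound_Diff[OF fin v(1)] deg2 by (simp add: t_def nbrs_def)
    obtain k where k: "pos_family (S - {v}) k"
      "2 * int k \<ge> bound (S - {v}) + (if two_regular (S - {v}) then 0 else 1)"
      using IH[OF _ v(2) card'] v(1) by blast
    have "2 * int k \<ge> bound S + (if two_regular S then 0 else 1)"
    \<comment> \<open>A neighbour of degree 2 becomes pendant, so \<open>S - {v}\<close> is no cycle
      and the induction hypothesis gains 1; the choice of \<open>v\<close> then gives
      \<open>deg S v + t >= 3\<close> unless \<open>S\<close> is a cycle. Without such a neighbour
      \<open>t = deg S v >= 2\<close>, and already \<open>-3 + deg S v + t >= 1\<close>.\<close>
    proof (cases "\<exists>x\<in>nbrs S v. deg S x = 2")
      case True
      then obtain x where x: "x \<in> nbrs S v" "deg S x = 2" by blast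
      then have "deg (S - {v}) x = 1" "x \<in> S - {v}"
        using deg_Diff[OF fin v(1), of x] w_sym[of v x] w_diag[of v] by (auto simp: nbrs_def)
      then have "\<not> two_regular (S - {v})" by (intro not_two_regularI[of x]) auto
      then have *: "2 * int k \<ge> bound S - 2 + int (deg S v) + int t" using k(2) b by simp
      show ?thesis
      proof (cases "deg S v = 2 \<and> t = 0")
        case True
        then have "{x \<in> nbrs S v. deg S x \<ge> 3} = {}" using finN by (simp add: t_def)
        then have "\<forall>x\<in>nbrs S v. deg S x = 2"
          using deg2 by (force simp: nbrs_def)
        then have "two_regular S" using v2 True by blast
        then show ?thesis using * True by simp
      next
        case False
        then show ?thesis using * deg2[OF v(1)] by auto
      qed
    next
      case False
      then have "{x \<in> nbrs S v. deg S x \<ge> 3} = nbrs S v"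
        using deg2 by (force simp: nbrs_def)
      then have "t = deg S v" by (simp add: t_def deg_def)
      then show ?thesis using k(2) b deg2[OF v(1)] by (auto split: if_splits)
    qed
    then show ?thesis using pos_family_mono[OF k(1), of S] by auto
  qed
qed

end

section \<open>Transfer to signed graphs and their cycles\<close>

context signed_graph
begin

lemma adj_entry_eq_0_iff: "adj_entry \<Gamma> u v \<noteq> 0 \<longleftrightarrow> {u, v} \<in> edges \<Gamma>"
  by (auto simp: adj_entry_def split: sign.splits)

sublocale weighted_graph "vertices \<Gamma>" "adj_entry \<Gamma>"
proof
  fix a b
  show "adj_entry \<Gamma> a b = adj_entry \<Gamma> b a" by (simp add: adj_entry_def insert_commute)
  have "{a, a} \<notin> edges \<Gamma>" using edges_wf[of "{a, a}"] by auto
  then show "adj_entry \<Gamma> a a = 0" using adj_entry_eq_0_iff by blast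
qed (rule finite_vertices)

lemma nbrs_vertices: "nbrs (vertices \<Gamma>) v = {u. {v, u} \<in> edges \<Gamma>}"
  using edges_wf by (auto simp: nbrs_def adj_entry_eq_0_iff)

lemma deg_eq_vertex_degree: "deg (vertices \<Gamma>) v = vertex_degree \<Gamma> v"
proof -
  have "{e \<in> edges \<Gamma>. v \<in> e} = (\<lambda>u. {v, u}) ` nbrs (vertices \<Gamma>) v"
  proof (intro equalityI subsetI)
    fix e assume e: "e \<in> {e \<in> edges \<Gamma>. v \<in> e}"
    then obtain x y where "e = {x, y}" using edges_wf[of e] by (auto simp: card_2_iff)
    then show "e \<in> (\<lambda>u. {v, u}) ` nbrs (vertices \<Gamma>) v"
      using e by (auto simp: nbrs_vertices insert_commute)
  qed (auto simp: nbrs_vertices)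
  moreover have "inj_on (\<lambda>u. {v, u}) (nbrs (vertices \<Gamma>) v)"
    by (auto simp: inj_on_def doubleton_eq_iff)
  ultimately show ?thesis by (simp add: deg_def vertex_degree_def card_image)
qed

lemma finite_edges: "finite (edges \<Gamma>)"
  by (rule finite_subset[of _ "Pow (vertices \<Gamma>)"]) (use edges_wf finite_vertices in auto)

lemma handshake: "(\<Sum>v\<in>vertices \<Gamma>. vertex_degree \<Gamma> v) = 2 * card (edges \<Gamma>)"
proof -
  have "(\<Sum>v\<in>vertices \<Gamma>. card {e \<in> edges \<Gamma>. v \<in> e}) = 2 * card (edges \<Gamma>)"
  proof (rule sum_multicount[OF finite_vertices finite_edges], rule ballI)
    fix e assume "e \<in> edges \<Gamma>"
    then have "{v \<in> vertices \<Gamma>. v \<in> e} = e" "card e = 2" using edges_wf by auto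
    then show "card {v \<in> vertices \<Gamma>. v \<in> e} = 2" by simp
  qed
  then show ?thesis by (simp add: vertex_degree_def)
qed

lemma conn_vertices:
  assumes "connected_sgraph \<Gamma>"
  shows "conn (vertices \<Gamma>)"
  unfolding conn_def
proof (intro conjI allI impI)
  show "vertices \<Gamma> \<noteq> {}" using assms by (simp add: connected_sgraph_def)
  fix T assume T: "T \<subset> vertices \<Gamma>" "T \<noteq> {}"
  then obtain x y where x: "x \<in> T" and y: "y \<in> vertices \<Gamma> - T" by blast
  then have "(x, y) \<in> (adj_rel \<Gamma>)\<^sup>*"
    using assms T by (auto simp: connected_sgraph_def reach_rel_def)
  \<comment> \<open>Followed along a path from \<open>x\<close>: as long as no edge leaving
    \<open>T\<close> has occurred, the current vertex is still in \<open>T\<close>.\<close>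
  then have "y \<in> T \<or> (\<exists>a\<in>T. \<exists>b\<in>vertices \<Gamma> - T. adj_entry \<Gamma> a b \<noteq> 0)"
  proof (induction rule: rtrancl_induct)
    case base
    then show ?case using x by blast
  next
    case (step b c)
    then have bc: "{b, c} \<in> edges \<Gamma>" by (simp add: adj_rel_def)
    then have "c \<in> vertices \<Gamma>" using edges_wf[OF bc] by blast
    then show ?case using step.IH bc adj_entry_eq_0_iff[of b c] by blast
  qed
  then show "\<exists>x\<in>T. \<exists>y\<in>vertices \<Gamma> - T. adj_entry \<Gamma> x y \<noteq> 0" using y by blast
qed

text \<open>This is where the constants 3 and 2 come from: with m edges and one component, theta = m
  - n + 1, so n - 2 theta = 3n - 2m - 2, and 2m is the sum of the degrees.\<close>

lemma bound_vertices:
  assumes "connected_sgraph \<Gamma>"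
  shows "bound (vertices \<Gamma>) =
    int (card (vertices \<Gamma>)) - int (num_pendant \<Gamma>) - 2 * cyclomatic \<Gamma>"
proof -
  have "reach_rel \<Gamma> = vertices \<Gamma> \<times> vertices \<Gamma>"
    using assms by (auto simp: connected_sgraph_def reach_rel_def)
  then have "components \<Gamma> = {vertices \<Gamma>}"
    using assms by (auto simp: components_def quotient_def connected_sgraph_def)
  then have cyc: "cyclomatic \<Gamma> = int (card (edges \<Gamma>)) - int (card (vertices \<Gamma>)) + 1"
    by (simp add: cyclomatic_def)
  have "(\<Sum>v\<in>vertices \<Gamma>. if vertex_degree \<Gamma> v = 1 then 1 else 0 :: int) = int (num_pendant \<Gamma>)"
    unfolding num_pendant_def using finite_vertices by (subst sum.inter_filter[symmetric]) auto
  then have "bound (vertices \<Gamma>) = 3 * int (card (vertices \<Gamma>))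
      - int (\<Sum>v\<in>vertices \<Gamma>. vertex_degree \<Gamma> v) - int (num_pendant \<Gamma>) - 2"
    by (simp add: bound_def contrib_def deg_eq_vertex_degree sum_subtractf)
  then show ?thesis unfolding handshake cyc by simp
qed

lemma pos_family_le_pos_inertia:
  assumes "pos_family (vertices \<Gamma>) k"
  shows "k \<le> pos_inertia \<Gamma>"
proof -
  define vs where "vs = vertex_list \<Gamma>"
  define n where "n = length vs"
  have vs: "distinct vs" "set vs = vertices \<Gamma>" using vertex_list by (auto simp: vs_def)
  have bij: "bij_betw ((!) vs) {..<n} (vertices \<Gamma>)"
    using bij_betw_nth[OF vs(1) refl, of "vertices \<Gamma>"] vs(2) by (simp add: n_def)
  obtain x where x: "(\<forall>i<k. \<forall>a. a \<notin> vertices \<Gamma> \<longrightarrow> x i a = 0) \<and>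
     (\<forall>i<k. \<forall>j<k. i \<noteq> j \<longrightarrow> bil (x i) (x j) = 0) \<and> (\<forall>i<k. bil (x i) (x i) > 0)"
    using assms unfolding pos_family_def by (rule exE)
  have A: "adj_matrix \<Gamma> \<in> carrier_mat n n"
    by (simp add: adj_matrix_def adj_matrix_wrt_def n_def vs_def)
  have entry: "adj_matrix \<Gamma> $$ (a, b) = adj_entry \<Gamma> (vs ! a) (vs ! b)" if "a < n" "b < n" for a b
    using that by (simp add: adj_matrix_def adj_matrix_wrt_def n_def vs_def)
  have sym: "transpose_mat (adj_matrix \<Gamma>) = adj_matrix \<Gamma>"
    using A entry w_sym by (intro eq_matI) auto
  have bil_eq: "(\<Sum>a<n. \<Sum>b<n. x i (vs ! a) * adj_matrix \<Gamma> $$ (a, b) * x j (vs ! b)) =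
      bil (x i) (x j)" for i j
  proof -
    have "bil (x i) (x j) = (\<Sum>a<n. \<Sum>b<n. x i (vs ! a) * adj_entry \<Gamma> (vs ! a) (vs ! b) * x j (vs ! b))"
      unfolding bil_def by (simp add: sum.reindex_bij_betw[OF bij, symmetric])
    then show ?thesis by (simp add: entry)
  qed
  show ?thesis
    unfolding pos_inertia_def
    by (rule pos_inertia_mat_ge[OF A sym, where x = "\<lambda>i a. x i (vs ! a)"])
      (use x in \<open>auto simp: bil_eq\<close>)
qed

text \<open>The two cycle edges at a vertex of the cycle are all the edges at that vertex, so the cycle
  is closed under adjacency.\<close>

lemma cycle_of_two_regular:
  assumes conn: "conn (vertices \<Gamma>)" and reg: "two_regular (vertices \<Gamma>)" and C: "C \<in> cycles \<Gamma>"
  shows "C = (vertices \<Gamma>, edges \<Gamma>)"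
proof -
  obtain vs where C_eq: "C = (set vs, cycle_edges vs)" and len: "length vs \<ge> 3"
    and dist: "distinct vs" and sub: "set vs \<subseteq> vertices \<Gamma>" "cycle_edges vs \<subseteq> edges \<Gamma>"
    using C by (auto simp: cycles_def)
  let ?n = "length vs"
  have in_cyc: "e \<in> cycle_edges vs" if v: "v \<in> set vs" "v \<in> e" and e: "e \<in> edges \<Gamma>" for v e
  proof -
    obtain i where i: "i < ?n" "v = vs ! i" using v(1) by (auto simp: in_set_conv_nth)
    \<comment> \<open>The cyclic predecessor of \<open>i\<close>. Since the length is at least 3, it
      differs from the successor \<open>k\<close>, so the two cycle edges at \<open>v\<close> are
      distinct and exhaust its degree 2.\<close>
    define j where "j = (if i = 0 then ?n - 1 else i - 1)"
    have j: "j < ?n" "Suc j mod ?n = i" "j \<noteq> i" using i len by (auto simp: j_def)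
    define k where "k = Suc i mod ?n"
    have k: "k < ?n" unfolding k_def by (rule mod_less_divisor) (use len in linarith)
    have "k = (if Suc i = ?n then 0 else Suc i)" using i by (auto simp: k_def)
    then have ki: "k \<noteq> i" "k \<noteq> j" using i len by (auto simp: j_def)
    let ?F = "{{vs ! j, v}, {v, vs ! k}}"
    have "{vs ! j, v} = {vs ! j, vs ! (Suc j mod ?n)}" "{v, vs ! k} = {vs ! i, vs ! (Suc i mod ?n)}"
      using i(2) j(2) by (simp_all add: k_def)
    then have F: "?F \<subseteq> cycle_edges vs" using i(1) j(1) unfolding cycle_edges_def by blast
    have "vs ! j \<noteq> vs ! k" using dist j(1) k ki(2) by (simp add: nth_eq_iff_index_eq)
    then have "{vs ! j, v} \<noteq> {v, vs ! k}" by (auto simp: doubleton_eq_iff)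
    then have "card ?F = 2" by simp
    moreover have "card {e \<in> edges \<Gamma>. v \<in> e} = 2"
      using reg v(1) sub(1) deg_eq_vertex_degree[of v] by (auto simp: two_regular_def vertex_degree_def)
    moreover have "?F \<subseteq> {e \<in> edges \<Gamma>. v \<in> e}" using F sub(2) by auto
    ultimately have "?F = {e \<in> edges \<Gamma>. v \<in> e}"
      using finite_edges by (intro card_subset_eq) auto
    then show ?thesis using F e v(2) by blast
  qed
  have cyc_sub: "e \<subseteq> set vs" if "e \<in> cycle_edges vs" for e
  proof -
    obtain i where i: "e = {vs ! i, vs ! (Suc i mod ?n)}" "i < ?n"
      using \<open>e \<in> cycle_edges vs\<close> by (auto simp: cycle_edges_def)
    moreover have "Suc i mod ?n < ?n" using i(2) by (intro mod_less_divisor) linarith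
    ultimately show ?thesis by auto
  qed
  have "set vs = vertices \<Gamma>"
  proof (rule ccontr)
    assume "set vs \<noteq> vertices \<Gamma>"
    then have "set vs \<subset> vertices \<Gamma>" "set vs \<noteq> {}" using sub(1) len by auto
    then obtain x y
      where xy: "x \<in> set vs" "y \<in> vertices \<Gamma> - set vs" "adj_entry \<Gamma> x y \<noteq> 0"
      by (rule connE[OF conn])
    then have "{x, y} \<in> edges \<Gamma>" by (simp add: adj_entry_eq_0_iff)
    with xy show False using in_cyc[of x "{x, y}"] cyc_sub[of "{x, y}"] by blast
  qed
  moreover have "edges \<Gamma> \<subseteq> cycle_edges vs"
  proof
    fix e assume e: "e \<in> edges \<Gamma>"
    have "e \<noteq> {}" using edges_wf[OF e] by auto
    then obtain v where "v \<in> e" "v \<in> vertices \<Gamma>" using edges_wf[OF e] by blast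
    then show "e \<in> cycle_edges vs" using in_cyc[of v e] e \<open>set vs = vertices \<Gamma>\<close> by simp
  qed
  ultimately show ?thesis using C_eq sub(2) by blast
qed

end

theorem theorem3p1:
  fixes \<Gamma> :: "'a sgraph" and n :: nat
  assumes "signed_graph \<Gamma>"
    and "connected_sgraph \<Gamma>"
    and "n = card (vertices \<Gamma>)"
    and "n \<ge> 2"
  shows "real (pos_inertia \<Gamma>) \<ge>
           (real n - real (num_pendant \<Gamma>)) / 2 - real_of_int (cyclomatic \<Gamma>) \<and>
         (num_pendant \<Gamma> \<ge> 1 \<or>
            (num_pendant \<Gamma> = 0 \<and>
              (\<exists>C \<in> cycles \<Gamma>. \<exists>D \<in> cycles \<Gamma>. C \<noteq> D \<and> fst C \<inter> fst D \<noteq> {}))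
          \<longrightarrow> real (pos_inertia \<Gamma>) \<ge>
             (real n - real (num_pendant \<Gamma>) + 1) / 2 - real_of_int (cyclomatic \<Gamma>))"
proof -
  interpret signed_graph \<Gamma> by (rule assms(1))
  have conn: "conn (vertices \<Gamma>)" using conn_vertices[OF assms(2)] .
  obtain k where k: "pos_family (vertices \<Gamma>) k"
    "2 * int k \<ge> bound (vertices \<Gamma>) + (if two_regular (vertices \<Gamma>) then 0 else 1)"
    using ex_pos_family[OF subset_refl conn] assms(3,4) by auto
  then have "2 * int (pos_inertia \<Gamma>) \<ge>
      int n - int (num_pendant \<Gamma>) - 2 * cyclomatic \<Gamma> + (if two_regular (vertices \<Gamma>) then 0 else 1)"
    using pos_family_le_pos_inertia[OF k(1)] bound_vertices[OF assms(2)] assms(3) by linarith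
  then have "real_of_int (2 * int (pos_inertia \<Gamma>)) \<ge> real_of_int (int n - int (num_pendant \<Gamma>)
      - 2 * cyclomatic \<Gamma> + (if two_regular (vertices \<Gamma>) then 0 else 1))"
    by (simp only: of_int_le_iff)
  then have main: "2 * real (pos_inertia \<Gamma>) \<ge> real n - real (num_pendant \<Gamma>)
      - 2 * real_of_int (cyclomatic \<Gamma>) + (if two_regular (vertices \<Gamma>) then 0 else 1)"
    by (simp split: if_splits)
  have "\<not> two_regular (vertices \<Gamma>)" if "num_pendant \<Gamma> \<ge> 1"
  proof -
    have "{v \<in> vertices \<Gamma>. vertex_degree \<Gamma> v = 1} \<noteq> {}"
      using that unfolding num_pendant_def by (metis card.empty not_one_le_zero)
    then show ?thesis by (force simp: two_regular_def deg_eq_vertex_degree)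
  qed
  moreover have "\<not> two_regular (vertices \<Gamma>)" if "C \<in> cycles \<Gamma>" "D \<in> cycles \<Gamma>" "C \<noteq> D" for C D
    using cycle_of_two_regular[OF conn _ that(1)] cycle_of_two_regular[OF conn _ that(2)] that(3)
    by blast
  ultimately have strict: "\<not> two_regular (vertices \<Gamma>)"
    if "num_pendant \<Gamma> \<ge> 1 \<or> (num_pendant \<Gamma> = 0 \<and>
      (\<exists>C \<in> cycles \<Gamma>. \<exists>D \<in> cycles \<Gamma>. C \<noteq> D \<and> fst C \<inter> fst D \<noteq> {}))"
    using that by blast
  show ?thesis
  proof (intro conjI impI)
    show "real (pos_inertia \<Gamma>) \<ge>
        (real n - real (num_pendant \<Gamma>)) / 2 - real_of_int (cyclomatic \<Gamma>)"
      using main by (simp add: field_simps split: if_splits)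
  next
    assume "num_pendant \<Gamma> \<ge> 1 \<or> (num_pendant \<Gamma> = 0 \<and>
      (\<exists>C \<in> cycles \<Gamma>. \<exists>D \<in> cycles \<Gamma>. C \<noteq> D \<and> fst C \<inter> fst D \<noteq> {}))"
    from strict[OF this] main show "real (pos_inertia \<Gamma>) \<ge>
        (real n - real (num_pendant \<Gamma>) + 1) / 2 - real_of_int (cyclomatic \<Gamma>)"
      by (simp add: field_simps)
  qed
qed

end
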